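(* For every $n\ge 1$ there is a bijection between the set $\mathcal{L}^w(n,n)$ of weighted $(n,n)$ Delannoy paths and the set of skew-symmetric $(n,n)$-clans. In particular, the number $Z_n$ of skew-symmetric $(n,n)$-clans equals $|\mathcal{L}^w(n,n)|$.
   Context: An $(n,n)$-clan is a string $\gamma=c_1\cdots c_{2n}$ of symbols from $\mathbb{N}\cup\{+,-\}$ such that each natural number appearing in $\gamma$ appears exactly twice, and the number of $+$'s equals the number of $-$'s; two clans are equal if they have the same $\pm$ symbols in the same positions and the same sets of positions of matching pairs of natural numbers. With $rev(\gamma)=c_{2n}\cdots c_1$ and $-\gamma$ obtained by interchanging $+$ and $-$, $\gamma$ is skew-symmetric if $\gamma=-rev(\gamma)$. An $(n,n)$ Delannoy path is a word in the alphabet $\{N,E,D\}$ in which (number of $N$'s) + (number of $D$'s) = (number of $E$'s) + (number of $D$'s) = $n$ (a lattice path from $(0,0)$ to $(n,n)$ with north, east and northeast diagonal unit steps). A labeled step is a pair $(L,l)$ with $L\in\{N,E,D\}$ and $l$ a positive integer, where $l=1$ if $L\in\{N,E\}$. A weighted $(n,n)$ Delannoy path is a word $W=W_1\cdots W_r$ of labeled steps $W_i=(L_i,l_i)$ such that: (1) $L_1\cdots L_r$ is an $(n,n)$ Delannoy path; (2) letting $W_{i_1}\cdots W_{i_t}$ ($i_1<\dots<i_t$) be the subword of all steps that are not equal to $(D,1)$, $t$ is even, and if $W_i=(D,1)$ then $i>i_{t/2}$; (3) for $1\le j\le t$, if $L_{i_j}=N$ then $L_{i_{t+1-j}}=E$,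 and if $L_{i_j}=E$ then $L_{i_{t+1-j}}=N$; (4) setting $d_i=\#\{k>i\mid W_k=(D,1)\}$ and $m_i=\#\{k<i\mid l_k\ne 1\}$, for each $1\le j\le t/2$ with $l_{i_j}\neq 1$ (so $L_{i_j}=D$) we have $W_{i_{t+1-j}}=\big(D,\;2n+3-2(i_j+m_{i_j}+d_{i_{t+1-j}})-l_{i_j}\big)$. $\mathcal{L}^w(n,n)$ denotes the set of all weighted $(n,n)$ Delannoy paths. *)

theory Defs
  imports Main
begin

section \<open>Skew-symmetric clans\<close>

datatype clan_symbol = Plus | Minus | Num nat

definition clan_strings :: "nat \<Rightarrow> clan_symbol list set" where
  "clan_strings n = {c. length c = 2 * n
     \<and> (\<forall>k. Num k \<in> set c \<longrightarrow> count_list c (Num k) = 2)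
     \<and> count_list c Plus = count_list c Minus}"

definition positions :: "clan_symbol \<Rightarrow> clan_symbol list \<Rightarrow> nat set" where
  "positions s c = {i. i < length c \<and> c ! i = s}"

definition matching_pairs :: "clan_symbol list \<Rightarrow> nat set set" where
  "matching_pairs c =
     {{i, j} | i j k. i < j \<and> j < length c \<and> c ! i = Num k \<and> c ! j = Num k}"

definition clan_rel :: "nat \<Rightarrow> (clan_symbol list \<times> clan_symbol list) set" where
  "clan_rel n = {(c, c'). c \<in> clan_strings n \<and> c' \<in> clan_strings n
     \<and> positions Plus c = positions Plus c'
     \<and> positions Minus c = positions Minus c'
     \<and> matching_pairs c = matching_pairs c'}"

text \<open>A clan is a string up to renaming of its natural numbers, so it is a class of
  \<open>clan_rel\<close>. Reversal and negation act on a class string by string; lemma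
  \<open>neg_rev_clan_class\<close> below confirms that the result is the class of the
  transformed representative.\<close>

definition clans :: "nat \<Rightarrow> clan_symbol list set set" where
  "clans n = clan_strings n // clan_rel n"

fun neg_symbol :: "clan_symbol \<Rightarrow> clan_symbol" where
  "neg_symbol Plus = Minus"
| "neg_symbol Minus = Plus"
| "neg_symbol (Num k) = Num k"

definition neg_clan :: "clan_symbol list set \<Rightarrow> clan_symbol list set" where
  "neg_clan C = map neg_symbol ` C"

definition rev_clan :: "clan_symbol list set \<Rightarrow> clan_symbol list set" where
  "rev_clan C = rev ` C"

definition skew_symmetric_clans :: "nat \<Rightarrow> clan_symbol list set set" where
  "skew_symmetric_clans n = {C \<in> clans n. C = neg_clan (rev_clan C)}"

definition Z :: "nat \<Rightarrow> nat" where
  "Z n = card (skew_symmetric_clans n)"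

lemma equiv_clan_rel: "equiv (clan_strings n) (clan_rel n)"
  by (rule equivI) (auto simp: clan_rel_def refl_on_def sym_def trans_def)

lemma neg_symbol_neg_symbol [simp]: "neg_symbol (neg_symbol s) = s"
  by (cases s) auto

lemma neg_symbol_eq_iff: "neg_symbol s = t \<longleftrightarrow> s = neg_symbol t"
  by auto

lemma count_list_neg: "count_list (map neg_symbol c) s = count_list c (neg_symbol s)"
  by (induction c) (auto simp: neg_symbol_eq_iff)

lemma neg_rev_in_clan_strings:
  assumes "c \<in> clan_strings n"
  shows "map neg_symbol (rev c) \<in> clan_strings n"
proof -
  have "Num k \<in> set c" if "Num k \<in> neg_symbol ` set c" for k
    using that by (metis imageE neg_symbol.simps(3) neg_symbol_neg_symbol)
  then show ?thesis
    using assms by (auto simp: clan_strings_def count_list_neg)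
qed

lemma positions_neg_rev:
  "positions s (map neg_symbol (rev c)) =
     (\<lambda>i. length c - Suc i) ` positions (neg_symbol s) c"
proof (intro set_eqI iffI)
  fix x assume "x \<in> positions s (map neg_symbol (rev c))"
  then have "length c - Suc x \<in> positions (neg_symbol s) c" "x = length c - Suc (length c - Suc x)"
    by (auto simp: positions_def rev_nth)
  then show "x \<in> (\<lambda>i. length c - Suc i) ` positions (neg_symbol s) c" by blast
qed (auto simp: positions_def rev_nth)

lemma matching_pairs_neg_rev:
  "matching_pairs (map neg_symbol (rev c)) =
     (\<lambda>S. (\<lambda>i. length c - Suc i) ` S) ` matching_pairs c" (is "?L = ?R")
proof (intro set_eqI iffI)
  fix S assume "S \<in> ?L"
  then obtain i j k where S: "S = {i, j}" and ij: "i < j" "j < length c"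
    and "map neg_symbol (rev c) ! i = Num k" "map neg_symbol (rev c) ! j = Num k"
    by (auto simp: matching_pairs_def)
  then have "c ! (length c - Suc i) = Num k" "c ! (length c - Suc j) = Num k"
    by (auto simp: rev_nth neg_symbol_eq_iff)
  then have "{length c - Suc j, length c - Suc i} \<in> matching_pairs c"
    unfolding matching_pairs_def using ij by fastforce
  moreover have "S = (\<lambda>i. length c - Suc i) ` {length c - Suc j, length c - Suc i}"
    using S ij by auto
  ultimately show "S \<in> ?R" by blast
next
  fix S assume "S \<in> ?R"
  then obtain i j k where S: "S = {length c - Suc j, length c - Suc i}"
    and ij: "i < j" "j < length c" and k: "c ! i = Num k" "c ! j = Num k"
    by (fastforce simp: matching_pairs_def)
  then have "map neg_symbol (rev c) ! (length c - Suc i) = Num k"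
      "map neg_symbol (rev c) ! (length c - Suc j) = Num k"
      "length c - Suc j < length c - Suc i" "length c - Suc i < length (map neg_symbol (rev c))"
    by (auto simp: rev_nth)
  then show "S \<in> ?L"
    unfolding S matching_pairs_def by blast
qed

lemma neg_rev_clan_rel:
  assumes "(c, c') \<in> clan_rel n"
  shows "(map neg_symbol (rev c), map neg_symbol (rev c')) \<in> clan_rel n"
proof -
  have "length c = length c'"
    using assms by (auto simp: clan_rel_def clan_strings_def)
  with assms show ?thesis
    by (simp add: clan_rel_def neg_rev_in_clan_strings positions_neg_rev matching_pairs_neg_rev)
qed

lemma neg_rev_clan_class:
  "neg_clan (rev_clan (clan_rel n `` {c})) = clan_rel n `` {map neg_symbol (rev c)}"
proof (intro set_eqI iffI)
  fix x assume "x \<in> clan_rel n `` {map neg_symbol (rev c)}"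
  then have "(c, map neg_symbol (rev x)) \<in> clan_rel n"
    using neg_rev_clan_rel[of "map neg_symbol (rev c)" x n] by (simp add: rev_map comp_def)
  moreover have "x = map neg_symbol (rev (map neg_symbol (rev x)))"
    by (simp add: rev_map comp_def)
  ultimately show "x \<in> neg_clan (rev_clan (clan_rel n `` {c}))"
    unfolding neg_clan_def rev_clan_def by blast
qed (auto simp: neg_clan_def rev_clan_def neg_rev_clan_rel)

section \<open>Weighted Delannoy paths\<close>

datatype step = N | E | D

type_synonym labeled_step = "step \<times> nat"

definition labeled_steps :: "labeled_step set" where
  "labeled_steps = {(L, l). l \<ge> 1 \<and> (L \<in> {N, E} \<longrightarrow> l = 1)}"

definition delannoy_paths :: "nat \<Rightarrow> step list set" where
  "delannoy_paths n = {w. count_list w N + count_list w D = n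
                        \<and> count_list w E + count_list w D = n}"

text \<open>Positions in words are counted from 1, since they enter the formula that determines
  the label of the mirror image of a diagonal step.\<close>

definition entry :: "'a list \<Rightarrow> nat \<Rightarrow> 'a" where
  "entry xs i = xs ! (i - 1)"

abbreviation letter :: "labeled_step list \<Rightarrow> nat \<Rightarrow> step" where
  "letter W i \<equiv> fst (entry W i)"

abbreviation label :: "labeled_step list \<Rightarrow> nat \<Rightarrow> nat" where
  "label W i \<equiv> snd (entry W i)"

text \<open>The increasing list $i_1 < \dots < i_t$ of positions of the steps other than $(D,1)$.\<close>

definition sub_positions :: "labeled_step list \<Rightarrow> nat list" where
  "sub_positions W = filter (\<lambda>i. entry W i \<noteq> (D, 1)) [1..<length W + 1]"

definition d_count :: "labeled_step list \<Rightarrow> nat \<Rightarrow> nat" where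
  "d_count W i = card {k. i < k \<and> k \<le> length W \<and> entry W k = (D, 1)}"

definition m_count :: "labeled_step list \<Rightarrow> nat \<Rightarrow> nat" where
  "m_count W i = card {k. 1 \<le> k \<and> k < i \<and> k \<le> length W \<and> label W k \<noteq> 1}"

text \<open>When $t = 0$ there is no $i_{t/2}$ and every step is $(D,1)$; the
  requirement that steps $(D,1)$ come after $i_{t/2}$ is then void, as if $i_0 = 0$. The label
  prescribed for the mirror image of a diagonal step is computed in the integers, so a
  nonpositive value rules the word out.\<close>

definition weighted_delannoy_paths :: "nat \<Rightarrow> labeled_step list set" where
  "weighted_delannoy_paths n = {W. set W \<subseteq> labeled_steps \<and>
     (let p = sub_positions W; t = length p; i = entry p in
        map fst W \<in> delannoy_paths n
      \<and> even t
      \<and> (t > 0 \<longrightarrow> (\<forall>k \<in> {1..length W}. entry W k = (D, 1) \<longrightarrow> k > i (t div 2)))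
      \<and> (\<forall>j \<in> {1..t}. (letter W (i j) = N \<longrightarrow> letter W (i (t + 1 - j)) = E)
                     \<and> (letter W (i j) = E \<longrightarrow> letter W (i (t + 1 - j)) = N))
      \<and> (\<forall>j \<in> {1..t div 2}. label W (i j) \<noteq> 1 \<longrightarrow>
            letter W (i (t + 1 - j)) = D
          \<and> int (label W (i (t + 1 - j))) =
              2 * int n + 3
              - 2 * (int (i j) + int (m_count W (i j)) + int (d_count W (i (t + 1 - j))))
              - int (label W (i j))))}"

end

theory Submission
  imports Defs
begin

text \<open>Both families are counted by the numbers with $z_0 = 1$ and
  $z_{n+1} = 3 z_n + 2 n z_{n-1}$.

  A weighted path of size $n + 1$ either ends in $(D,1)$, or its first and last steps are mirror
  images of each other. Deleting the final $(D,1)$, or both end steps, changes the quantities in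
  condition (4) by amounts that cancel, so what remains is an arbitrary weighted path: of size $n$
  after deleting $(D,1)$, a pair $N, E$ or a pair $E, N$, and of size $n - 1$ after deleting
  $(D,l), (D,l')$, where $l + l' = 2n + 3$ and $l, l' \ge 2$ leave $2n$ choices for $l$.

  A skew-symmetric clan is determined by the positions of its plus signs and by its matching.
  The first position carries a sign, which fixes the sign of its mirror image, or is matched with
  its mirror image, or is matched with one of $2n$ other positions, in which case the mirror image
  of this pair is matched as well. What remains lives on $2n$, respectively $2n - 2$ positions.
  To avoid renumbering positions, these objects are counted on an arbitrary finite set with a
  fixed-point-free involution.\<close>

fun skew_clan_number :: "nat \<Rightarrow> nat" where
  "skew_clan_number 0 = 1"
| "skew_clan_number (Suc n) = 3 * skew_clan_number n + 2 * n * skew_clan_number (n - 1)"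

section \<open>Counting weighted Delannoy paths\<close>

lemma entry_Cons_snoc:
  "0 < i \<Longrightarrow> i \<le> length W \<Longrightarrow> entry (x # W @ [y]) (Suc i) = entry W i"
  "entry (x # xs) (Suc 0) = x"
  "i = length W + 2 \<Longrightarrow> entry (x # W @ [y]) i = y"
  by (auto simp: entry_def nth_append nth_Cons')

lemma entry_snoc: "0 < i \<Longrightarrow> i \<le> length W \<Longrightarrow> entry (W @ [y]) i = entry W i"
  "i = Suc (length W) \<Longrightarrow> entry (W @ [y]) i = y"
  by (auto simp: entry_def nth_append)

lemma sub_positions_snoc:
  "sub_positions (W @ [y]) = sub_positions W @ (if y = (D, 1) then [] else [Suc (length W)])"
proof -
  have "filter (\<lambda>i. entry (W @ [y]) i \<noteq> (D, 1)) [1..<length W + 1] = sub_positions W"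
    unfolding sub_positions_def by (rule filter_cong) (auto simp: entry_snoc simp del: upt_Suc)
  then show ?thesis by (simp add: sub_positions_def entry_snoc)
qed

lemma sub_positions_Cons_snoc:
  assumes "x \<noteq> (D, 1)" "y \<noteq> (D, 1)"
  shows "sub_positions (x # W @ [y]) = 1 # map Suc (sub_positions W) @ [length W + 2]"
proof -
  have "[1..<length (x # W @ [y]) + 1] = 1 # map Suc [1..<length W + 1] @ [length W + 2]"
    by (intro nth_equalityI) (auto simp: nth_append nth_Cons' simp del: upt_Suc)
  moreover have "filter (\<lambda>i. entry (x # W @ [y]) i \<noteq> (D, 1)) (map Suc [1..<length W + 1]) =
      map Suc (sub_positions W)"
    unfolding sub_positions_def filter_map
    by (intro arg_cong[where f = "map Suc"] filter_cong)
      (auto simp: entry_Cons_snoc simp del: upt_Suc)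
  ultimately show ?thesis
    using assms by (simp add: sub_positions_def entry_Cons_snoc del: upt_Suc)
qed

lemma entry_sub_positions:
  assumes "1 \<le> j" "j \<le> length (sub_positions W)"
  shows "0 < entry (sub_positions W) j" "entry (sub_positions W) j \<le> length W"
proof -
  have "entry (sub_positions W) j \<in> set (sub_positions W)"
    using assms by (auto simp: entry_def intro!: nth_mem)
  then show "0 < entry (sub_positions W) j" "entry (sub_positions W) j \<le> length W"
    by (auto simp: sub_positions_def simp del: upt_Suc)
qed

text \<open>The appended step lies to the right of every position of \<open>W\<close>. In condition
  (4) this extra unit, doubled, offsets the growth of \<open>2 * n\<close> when \<open>n\<close>
  becomes \<open>Suc n\<close>.\<close>

lemma d_count_snoc:
  assumes "i \<le> length W" shows "d_count (W @ [(D, 1)]) i = Suc (d_count W i)"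
proof -
  have "{k. i < k \<and> k \<le> length (W @ [(D, 1)]) \<and> entry (W @ [(D, 1)]) k = (D, 1)} =
      insert (Suc (length W)) {k. i < k \<and> k \<le> length W \<and> entry W k = (D, 1)}"
    using assms by (auto simp: entry_snoc le_Suc_eq)
  then show ?thesis by (simp add: d_count_def)
qed

lemma m_count_snoc:
  assumes "i \<le> length W" shows "m_count (W @ [y]) i = m_count W i"
proof -
  have "{k. 1 \<le> k \<and> k < i \<and> k \<le> length (W @ [y]) \<and> label (W @ [y]) k \<noteq> 1} =
      {k. 1 \<le> k \<and> k < i \<and> k \<le> length W \<and> label W k \<noteq> 1}"
    using assms by (auto simp: entry_snoc le_Suc_eq)
  then show ?thesis by (simp add: m_count_def)
qed

text \<open>Old positions move right by one and neither end is counted: \<open>x\<close> stands to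
  the left of position \<open>Suc i\<close>, and \<open>y\<close> is not
  \<open>(D, 1)\<close>.\<close>

lemma d_count_Cons_snoc:
  assumes "0 < i" "y \<noteq> (D, 1)" shows "d_count (x # W @ [y]) (Suc i) = d_count W i"
proof -
  have "{k. Suc i < k \<and> k \<le> length (x # W @ [y]) \<and> entry (x # W @ [y]) k = (D, 1)} =
      Suc ` {k. i < k \<and> k \<le> length W \<and> entry W k = (D, 1)}" (is "?L = ?R")
  proof (intro set_eqI iffI)
    fix k assume k: "k \<in> ?L"
    then obtain k' where "k = Suc k'" by (cases k) auto
    with k assms show "k \<in> ?R"
      by (cases "k' = Suc (length W)") (auto simp: entry_Cons_snoc)
  next
    fix k assume "k \<in> ?R" then show "k \<in> ?L"
      using assms by (auto simp: entry_Cons_snoc)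
  qed
  then show ?thesis by (simp add: d_count_def card_image)
qed

text \<open>The new first step precedes every old position, so it counts exactly when its label is
  not 1. Together with the shift of the position itself, position plus \<open>m_count\<close> in
  condition (4) grows by 2 in that case and by 1 otherwise.\<close>

lemma m_count_Cons_snoc:
  assumes "0 < i" "i \<le> length W"
  shows "m_count (x # W @ [y]) (Suc i) = (if snd x = 1 then 0 else 1) + m_count W i"
proof -
  have "{k. 1 \<le> k \<and> k < Suc i \<and> k \<le> length (x # W @ [y]) \<and> label (x # W @ [y]) k \<noteq> 1} =
      (if snd x = 1 then {} else {1}) \<union>
      Suc ` {k. 1 \<le> k \<and> k < i \<and> k \<le> length W \<and> label W k \<noteq> 1}" (is "?L = ?R")
  proof (intro set_eqI iffI)
    fix k assume k: "k \<in> ?L"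
    then obtain k' where k': "k = Suc k'" by (cases k) auto
    with k assms show "k \<in> ?R" by (cases k') (auto simp: entry_Cons_snoc)
  next
    fix k assume "k \<in> ?R" then show "k \<in> ?L"
      using assms by (auto simp: entry_Cons_snoc split: if_splits)
  qed
  moreover have "finite {k. 1 \<le> k \<and> k < i \<and> k \<le> length W \<and> label W k \<noteq> 1}" by simp
  then have "card ?R = (if snd x = 1 then 0 else 1) + card {k. 1 \<le> k \<and> k < i \<and> k \<le> length W
    \<and> label W k \<noteq> 1}"
    by (subst card_Un_disjoint) (auto simp: card_image)
  ultimately show ?thesis by (simp only: m_count_def)
qed

text \<open>For the outermost pair, where the position is 1, these values turn condition (4) into
  \<open>l + l' = 2 * n + 1\<close>.\<close>

lemma count_endpoints:
  "m_count W (Suc 0) = 0" "length W \<le> i \<Longrightarrow> d_count W i = 0"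
  by (auto simp: m_count_def d_count_def)

section \<open>Conditions on weighted paths after adding end steps\<close>

lemma weighted_delannoy_paths_iff:
  "W \<in> weighted_delannoy_paths n \<longleftrightarrow> (let p = sub_positions W; t = length p; i = entry p in
        set W \<subseteq> labeled_steps
      \<and> map fst W \<in> delannoy_paths n
      \<and> even t
      \<and> (t > 0 \<longrightarrow> (\<forall>k \<in> {1..length W}. entry W k = (D, 1) \<longrightarrow> k > i (t div 2)))
      \<and> (\<forall>j \<in> {1..t}. (letter W (i j) = N \<longrightarrow> letter W (i (t + 1 - j)) = E)
                     \<and> (letter W (i j) = E \<longrightarrow> letter W (i (t + 1 - j)) = N))
      \<and> (\<forall>j \<in> {1..t div 2}. label W (i j) \<noteq> 1 \<longrightarrow>
            letter W (i (t + 1 - j)) = D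
          \<and> int (label W (i (t + 1 - j))) =
              2 * int n + 3
              - 2 * (int (i j) + int (m_count W (i j)) + int (d_count W (i (t + 1 - j))))
              - int (label W (i j))))"
  by (simp add: weighted_delannoy_paths_def Let_def)

text \<open>The positions of the steps other than \<open>(D, 1)\<close> stay the same, and in
  condition (4) the passage from \<open>n\<close> to \<open>Suc n\<close> cancels against the one
  additional \<open>(D, 1)\<close> to the right.\<close>

lemma snoc_D1_in_weighted_delannoy_paths_iff:
  "W @ [(D, 1)] \<in> weighted_delannoy_paths (Suc n) \<longleftrightarrow> W \<in> weighted_delannoy_paths n"
proof -
  define p where "p = sub_positions W"
  define t where "t = length p"
  have p': "sub_positions (W @ [(D, 1)]) = p"
    by (simp add: p_def sub_positions_snoc)
  have i: "0 < entry p j" "entry p j \<le> length W" if "1 \<le> j" "j \<le> t" for j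
    using entry_sub_positions that by (auto simp: p_def t_def)
  \<comment> \<open>The new step stands beyond all of \<open>W\<close>, hence beyond
    \<open>entry p (t div 2)\<close>, and satisfies condition (2) by itself.\<close>
  have "(0 < t \<longrightarrow> (\<forall>k\<in>{1..Suc (length W)}. entry (W @ [(D, 1)]) k = (D, 1) \<longrightarrow> entry p (t div 2) < k))
     \<longleftrightarrow> (0 < t \<longrightarrow> (\<forall>k\<in>{1..length W}. entry W k = (D, 1) \<longrightarrow> entry p (t div 2) < k))" if "even t"
  proof (cases "t = 0")
    case False
    then have "entry p (t div 2) \<le> length W" using that by (intro i) auto
    then show ?thesis by (auto simp: atLeastAtMostSuc_conv entry_snoc)
  qed auto
  moreover have "(\<forall>j \<in> {1..t}. (letter (W @ [(D, 1)]) (entry p j) = N \<longrightarrow>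
    letter (W @ [(D, 1)]) (entry p (t + 1 - j)) = E)
                     \<and> (letter (W @ [(D, 1)]) (entry p j) = E \<longrightarrow>
                       letter (W @ [(D, 1)]) (entry p (t + 1 - j)) = N))
     \<longleftrightarrow> (\<forall>j \<in> {1..t}. (letter W (entry p j) = N \<longrightarrow> letter W (entry p (t + 1 - j)) = E)
                     \<and> (letter W (entry p j) = E \<longrightarrow> letter W (entry p (t + 1 - j)) = N))"
  proof (intro ball_cong refl, goal_cases)
    case (1 j)
    then have "1 \<le> j" "j \<le> t" "1 \<le> t + 1 - j" "t + 1 - j \<le> t" by auto
    then show ?case by (simp only: entry_snoc i)
  qed
  moreover have "(\<forall>j \<in> {1..t div 2}. label (W @ [(D, 1)]) (entry p j) \<noteq> 1 \<longrightarrow>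
            letter (W @ [(D, 1)]) (entry p (t + 1 - j)) = D
          \<and> int (label (W @ [(D, 1)]) (entry p (t + 1 - j))) =
              2 * int (Suc n) + 3
              - 2 * (int (entry p j) + int (m_count (W @ [(D, 1)]) (entry p j))
                + int (d_count (W @ [(D, 1)]) (entry p (t + 1 - j))))
              - int (label (W @ [(D, 1)]) (entry p j))) \<longleftrightarrow>
         (\<forall>j \<in> {1..t div 2}. label W (entry p j) \<noteq> 1 \<longrightarrow>
            letter W (entry p (t + 1 - j)) = D
          \<and> int (label W (entry p (t + 1 - j))) =
              2 * int n + 3
              - 2 * (int (entry p j) + int (m_count W (entry p j))
                + int (d_count W (entry p (t + 1 - j))))
              - int (label W (entry p j)))"
  proof (intro ball_cong refl, goal_cases)
    case (1 j)
    then have "1 \<le> j" "j \<le> t" "1 \<le> t + 1 - j" "t + 1 - j \<le> t" by auto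
    then show ?case
      by (simp only: entry_snoc i d_count_snoc m_count_snoc) (simp add: algebra_simps)
  qed
  ultimately show ?thesis
    unfolding weighted_delannoy_paths_iff Let_def p' p_def[symmetric] t_def[symmetric]
    by (auto simp: delannoy_paths_def labeled_steps_def)
qed

text \<open>Matches the shape of \<open>sub_positions_Cons_snoc\<close>: two outer indices, and the
  inner ones shifted by one.\<close>

lemma ball_Icc_Suc_Suc: "(\<forall>j\<in>{1..t + 2}. Q j) \<longleftrightarrow> Q 1 \<and> Q (t + 2) \<and> (\<forall>j\<in>{1..t}. Q (Suc j))"
  for t :: nat
proof -
  have "{1..t + 2} = insert 1 (insert (t + 2) (Suc ` {1..t}))" by auto
  then show ?thesis by (simp only: ball_simps)
qed

text \<open>Serves condition (4), whose index runs over the first half only, so that just one outer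
  index occurs.\<close>

lemma ball_Icc_Suc: "(\<forall>j\<in>{1..Suc t}. Q j) \<longleftrightarrow> Q 1 \<and> (\<forall>j\<in>{1..t}. Q (Suc j))" for t :: nat
proof -
  have "{1..Suc t} = insert 1 (Suc ` {1..t})" by auto
  then show ?thesis by (simp only: ball_simps)
qed

text \<open>The amount by which a path grows when a step and its mirror step are added at its ends.\<close>

definition step_size :: "labeled_step \<Rightarrow> nat" where
  "step_size x = (if fst x = D then 2 else 1)"

text \<open>Here \<open>n\<close> is the size of the whole path with ends \<open>x\<close> and
  \<open>y\<close>. The sum of the labels is condition (4) at position 1 with both counts zero,
  \<open>l' = 2 * n + 3 - 2 - l\<close>; the lower bounds keep \<open>(D, 1)\<close> away from the
  ends.\<close>

definition mirror_steps :: "nat \<Rightarrow> labeled_step \<Rightarrow> labeled_step \<Rightarrow> bool" where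
  "mirror_steps n x y \<longleftrightarrow> x = (N, 1) \<and> y = (E, 1) \<or> x = (E, 1) \<and> y = (N, 1) \<or>
     (\<exists>l l'. x = (D, l) \<and> y = (D, l') \<and> 2 \<le> l \<and> 2 \<le> l' \<and> l + l' = 2 * n + 1)"

text \<open>For a pair inside \<open>W\<close>, the position grows by 1, \<open>m_count\<close>
  grows by 1 exactly when \<open>x\<close> is diagonal, and \<open>d_count\<close> is unchanged. The
  sum in condition (4) thus grows by \<open>step_size x\<close>, just as the size of the path does.
  The outer pair contributes the condition \<open>mirror_steps\<close>.\<close>

lemma Cons_snoc_in_weighted_delannoy_paths_iff:
  assumes x: "x \<noteq> (D, 1)" and y: "y \<noteq> (D, 1)"
  shows "x # W @ [y] \<in> weighted_delannoy_paths n \<longleftrightarrow>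
    mirror_steps n x y \<and> step_size x \<le> n \<and> W \<in> weighted_delannoy_paths (n - step_size x)"
proof -
  define p where "p = sub_positions W"
  define t where "t = length p"
  define V where "V = x # W @ [y]"
  define q where "q = 1 # map Suc p @ [length W + 2]"
  have q: "sub_positions V = q"
    using sub_positions_Cons_snoc[OF x y] by (simp add: p_def q_def V_def)
  have len_q: "length q = t + 2" by (simp add: q_def t_def)
  have lenV: "length V = length W + 2" by (simp add: V_def)
  have i: "0 < entry p j" "entry p j \<le> length W" if "1 \<le> j" "j \<le> t" for j
    using entry_sub_positions that by (auto simp: p_def t_def)
  have q_mid: "entry q (Suc j) = Suc (entry p j)" if "1 \<le> j" "j \<le> t" for j
    using that by (auto simp: entry_def q_def t_def nth_append nth_Cons')
  have q_end: "entry q 1 = 1" "entry q (Suc 0) = 1" "entry q (t + 2) = length W + 2"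
    "entry q (Suc (Suc t)) = length W + 2"
    by (auto simp: entry_def q_def t_def nth_append)
  have V_mid: "entry V (entry q (Suc j)) = entry W (entry p j)" if "1 \<le> j" "j \<le> t" for j
    using that by (simp add: q_mid V_def entry_Cons_snoc i)
  have V_end: "entry V 1 = x" "entry V (Suc 0) = x" "entry V (length W + 2) = y"
    "entry V (Suc (Suc (length W))) = y"
    by (auto simp: V_def entry_Cons_snoc)
  have counts: "m_count V (entry q (Suc j)) = (if snd x = 1 then 0 else 1) + m_count W (entry p j)"
      "d_count V (entry q (Suc j)) = d_count W (entry p j)" if "1 \<le> j" "j \<le> t" for j
    using that y by (simp_all add: q_mid V_def m_count_Cons_snoc d_count_Cons_snoc i)
  have half: "(t + 2) div 2 = Suc (t div 2)" by simp
  have D1: "(0 < t + 2 \<longrightarrow> (\<forall>k\<in>{1..length W + 2}. entry V k = (D, 1) \<longrightarrow> entry q ((t + 2) div 2) < k))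
     \<longleftrightarrow> (0 < t \<longrightarrow> (\<forall>k\<in>{1..length W}. entry W k = (D, 1) \<longrightarrow> entry p (t div 2) < k))" if "even t"
  proof (cases "t = 0")
    \<comment> \<open>For \<open>t = 0\<close> the right side is void, and the left side only says
      that position 1 does not carry \<open>(D, 1)\<close>.\<close>
    case True
    have "1 < k" if "1 \<le> k" "entry V k = (D, 1)" for k
      using that x V_end(1) by (cases "k = 1") auto
    then show ?thesis using True by (simp add: half q_end)
  next
    case False
    then have "1 \<le> t div 2" "t div 2 \<le> t" using that by auto
    then have "(\<forall>k\<in>{1..length W + 2}. entry V k = (D, 1) \<longrightarrow> entry q ((t + 2) div 2) < k) \<longleftrightarrow>
       (\<forall>k\<in>{1..length W}. entry V (Suc k) = (D, 1) \<longrightarrow> entry p (t div 2) < k)"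
      unfolding ball_Icc_Suc_Suc half using x y by (simp add: V_end q_mid)
    also have "\<dots> \<longleftrightarrow> (\<forall>k\<in>{1..length W}. entry W k = (D, 1) \<longrightarrow> entry p (t div 2) < k)"
      by (intro ball_cong refl) (simp add: V_def entry_Cons_snoc)
    finally show ?thesis using False by simp
  qed
  \<comment> \<open>The reflection \<open>j \<mapsto> t + 3 - j\<close> swaps 1 and
    \<open>t + 2\<close> and sends \<open>Suc j\<close> to \<open>Suc (t + 1 - j)\<close>, so inner
    pairs correspond to the pairs of \<open>W\<close>.\<close>
  have letters: "(\<forall>j \<in> {1..t + 2}.
                       (letter V (entry q j) = N \<longrightarrow> letter V (entry q (t + 2 + 1 - j)) = E)
                     \<and> (letter V (entry q j) = E \<longrightarrow> letter V (entry q (t + 2 + 1 - j)) = N))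
     \<longleftrightarrow> ((fst x = N \<longrightarrow> fst y = E) \<and> (fst x = E \<longrightarrow> fst y = N) \<and> (fst y = N \<longrightarrow> fst x = E)
       \<and> (fst y = E \<longrightarrow> fst x = N)) \<and>
       (\<forall>j \<in> {1..t}. (letter W (entry p j) = N \<longrightarrow> letter W (entry p (t + 1 - j)) = E)
                     \<and> (letter W (entry p j) = E \<longrightarrow> letter W (entry p (t + 1 - j)) = N))"
  proof -
    have "(\<forall>j \<in> {1..t}. (letter V (entry q (Suc j)) = N \<longrightarrow>
      letter V (entry q (t + 2 + 1 - Suc j)) = E)
                     \<and> (letter V (entry q (Suc j)) = E \<longrightarrow>
                       letter V (entry q (t + 2 + 1 - Suc j)) = N))
      \<longleftrightarrow> (\<forall>j \<in> {1..t}. (letter W (entry p j) = N \<longrightarrow> letter W (entry p (t + 1 - j)) = E)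
                     \<and> (letter W (entry p j) = E \<longrightarrow> letter W (entry p (t + 1 - j)) = N))"
    proof (intro ball_cong refl, goal_cases)
      case (1 j)
      then have j: "1 \<le> j" "j \<le> t" "1 \<le> t + 1 - j" "t + 1 - j \<le> t"
        "t + 2 + 1 - Suc j = Suc (t + 1 - j)" by auto
      show ?case unfolding j(5) V_mid[OF j(1,2)] V_mid[OF j(3,4)] by (rule refl)
    qed
    then show ?thesis unfolding ball_Icc_Suc_Suc by (auto simp: q_end V_end)
  qed
  have labels: "(\<forall>j \<in> {1..(t + 2) div 2}. label V (entry q j) \<noteq> 1 \<longrightarrow>
            letter V (entry q (t + 2 + 1 - j)) = D
          \<and> int (label V (entry q (t + 2 + 1 - j))) =
              2 * int n + 3
              - 2 * (int (entry q j) + int (m_count V (entry q j))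
                + int (d_count V (entry q (t + 2 + 1 - j))))
              - int (label V (entry q j))) \<longleftrightarrow>
         (snd x \<noteq> 1 \<longrightarrow> fst y = D \<and> int (snd y) = 2 * int n + 1 - int (snd x)) \<and>
         (\<forall>j \<in> {1..t div 2}. label W (entry p j) \<noteq> 1 \<longrightarrow>
            letter W (entry p (t + 1 - j)) = D
          \<and> int (label W (entry p (t + 1 - j))) =
              2 * int (n - step_size x) + 3
              - 2 * (int (entry p j) + int (m_count W (entry p j))
                + int (d_count W (entry p (t + 1 - j))))
              - int (label W (entry p j)))"
    if le: "step_size x \<le> n" and xD: "snd x \<noteq> 1 \<longleftrightarrow> fst x = D"
  proof -
    \<comment> \<open>\<open>le\<close> makes the natural subtraction exact, and \<open>xD\<close>
      translates the case distinction on letters in \<open>step_size\<close> into the one on labels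
      in \<open>m_count_Cons_snoc\<close>.\<close>
    have n: "int (n - step_size x) = int n - 1 - (if snd x = 1 then 0 else 1)"
      using le xD by (auto simp: step_size_def)
    have "(\<forall>j \<in> {1..t div 2}. label V (entry q (Suc j)) \<noteq> 1 \<longrightarrow>
            letter V (entry q (t + 2 + 1 - Suc j)) = D
          \<and> int (label V (entry q (t + 2 + 1 - Suc j))) =
              2 * int n + 3
              - 2 * (int (entry q (Suc j)) + int (m_count V (entry q (Suc j)))
                + int (d_count V (entry q (t + 2 + 1 - Suc j))))
              - int (label V (entry q (Suc j)))) \<longleftrightarrow>
         (\<forall>j \<in> {1..t div 2}. label W (entry p j) \<noteq> 1 \<longrightarrow>
            letter W (entry p (t + 1 - j)) = D
          \<and> int (label W (entry p (t + 1 - j))) =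
              2 * int (n - step_size x) + 3
              - 2 * (int (entry p j) + int (m_count W (entry p j))
                + int (d_count W (entry p (t + 1 - j))))
              - int (label W (entry p j)))"
    proof (intro ball_cong refl, goal_cases)
      case (1 j)
      then have j: "1 \<le> j" "j \<le> t" "1 \<le> t + 1 - j" "t + 1 - j \<le> t"
        "t + 2 + 1 - Suc j = Suc (t + 1 - j)" by auto
      show ?case
        unfolding j(5) V_mid[OF j(1,2)] V_mid[OF j(3,4)] counts[OF j(1,2)] counts[OF j(3,4)] n
        unfolding q_mid[OF j(1,2)]
        by (simp add: algebra_simps)
    qed
    then show ?thesis unfolding half ball_Icc_Suc
      by (auto simp: q_end V_end count_endpoints lenV)
  qed
  \<comment> \<open>The letter conditions in both directions rule out a diagonal step opposite
    \<open>N\<close> or \<open>E\<close>. A diagonal end differs from \<open>(D, 1)\<close>, so its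
    label is at least 2.\<close>
  have ends: "{x, y} \<subseteq> labeled_steps \<and>
      ((fst x = N \<longrightarrow> fst y = E) \<and> (fst x = E \<longrightarrow> fst y = N) \<and> (fst y = N \<longrightarrow> fst x = E)
        \<and> (fst y = E \<longrightarrow> fst x = N)) \<and>
      (snd x \<noteq> 1 \<longrightarrow> fst y = D \<and> int (snd y) = 2 * int n + 1 - int (snd x)) \<longleftrightarrow> mirror_steps n x y"
  proof -
    obtain L l L' l' where "x = (L, l)" "y = (L', l')" by fastforce
    with x y show ?thesis
      by (cases L; cases L') (auto simp: labeled_steps_def mirror_steps_def)
  qed
  have path: "map fst V \<in> delannoy_paths n \<longleftrightarrow> step_size x \<le> n
    \<and> map fst W \<in> delannoy_paths (n - step_size x)"
    if "mirror_steps n x y"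
    using that by (auto simp: mirror_steps_def V_def delannoy_paths_def step_size_def)
  have xD: "snd x \<noteq> 1 \<longleftrightarrow> fst x = D" if "{x, y} \<subseteq> labeled_steps"
    using x that by (cases x; cases "fst x") (auto simp: labeled_steps_def)
  have setV: "set V \<subseteq> labeled_steps \<longleftrightarrow> {x, y} \<subseteq> labeled_steps \<and> set W \<subseteq> labeled_steps"
    by (auto simp: V_def)
  \<comment> \<open>\<open>labels\<close> presupposes \<open>step_size x \<le> n\<close>, so this
    bound has to come from the letters alone: the ends are one \<open>N\<close> and one
    \<open>E\<close>, or two \<open>D\<close>.\<close>
  have size: "step_size x \<le> n"
    if "{x, y} \<subseteq> labeled_steps" "fst x = N \<longrightarrow> fst y = E" "fst x = E \<longrightarrow> fst y = N"
      "fst y = N \<longrightarrow> fst x = E" "fst y = E \<longrightarrow> fst x = N" "map fst V \<in> delannoy_paths n"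
  proof -
    obtain L l L' l' where "x = (L, l)" "y = (L', l')" by fastforce
    with that show ?thesis
      by (cases L; cases L') (auto simp: V_def delannoy_paths_def step_size_def)
  qed
  have even: "even (t + 2) \<longleftrightarrow> even t" by simp
  show ?thesis
  \<comment> \<open>\<open>D1\<close>, \<open>labels\<close> and \<open>path\<close> hold under side
    conditions. If all of these hold, the two sides agree conjunct by conjunct; if one fails, both
    sides are false.\<close>
  proof (cases "mirror_steps n x y \<and> step_size x \<le> n \<and> even t")
    case True
    then have m: "mirror_steps n x y" and le: "step_size x \<le> n" and ev: "even t" by simp_all
    note conds = m[folded ends]
    then have xy: "{x, y} \<subseteq> labeled_steps" by (rule conjunct1)
    show ?thesis
      unfolding weighted_delannoy_paths_iff Let_def V_def[symmetric] q p_def[symmetric]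
        t_def[symmetric]
        len_q lenV letters setV even D1[OF ev] labels[OF le xD[OF xy]] path[OF m]
      using conds m le ev by (elim conjE) (rule iffI; elim conjE; intro conjI; assumption)
  next
    case False
    have "V \<notin> weighted_delannoy_paths n"
    proof
      assume "V \<in> weighted_delannoy_paths n"
      note V = this[unfolded weighted_delannoy_paths_iff Let_def q len_q lenV letters setV even]
      then have le: "step_size x \<le> n" by (intro size) blast+
      from V have "{x, y} \<subseteq> labeled_steps" by blast
      from V[unfolded labels[OF le xD[OF this]]] have "mirror_steps n x y"
        unfolding ends[symmetric] by (elim conjE) (intro conjI; assumption)
      with False le V show False by blast
    qed
    with False show ?thesis
      unfolding weighted_delannoy_paths_iff Let_def V_def[symmetric] p_def[symmetric]
        t_def[symmetric]
      by blast
  qed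
qed

section \<open>The recurrence for weighted paths\<close>

lemma weighted_delannoy_paths_0: "weighted_delannoy_paths 0 = {[]}"
proof -
  have "W = []" if "W \<in> weighted_delannoy_paths 0" for W
  proof (cases W)
    case (Cons a W')
    then have "map fst W \<in> delannoy_paths 0" using that
      by (simp add: weighted_delannoy_paths_def Let_def)
    with Cons show ?thesis by (cases "fst a") (auto simp: delannoy_paths_def)
  qed auto
  moreover have "[] \<in> weighted_delannoy_paths 0"
    by (simp add: weighted_delannoy_paths_def delannoy_paths_def sub_positions_def)
  ultimately show ?thesis by blast
qed

text \<open>If the last step is not \<open>(D, 1)\<close>, the subword is nonempty, and condition
  (2) keeps every \<open>(D, 1)\<close> to the right of some position that is at least 1. Hence the
  first step is not \<open>(D, 1)\<close> either.\<close>

lemma weighted_delannoy_paths_cases: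
  assumes "W \<in> weighted_delannoy_paths (Suc n)"
  obtains (snoc) W' where "W = W' @ [(D, 1)]"
  | (Cons_snoc) x W' y where "W = x # W' @ [y]" "x \<noteq> (D, 1)" "y \<noteq> (D, 1)"
proof (cases W rule: rev_cases)
  case Nil
  with assms show ?thesis by (simp add: weighted_delannoy_paths_def delannoy_paths_def Let_def)
next
  case (snoc U y)
  show ?thesis
  proof (cases "y = (D, 1)")
    case False
    define t where "t = length (sub_positions W)"
    have t: "t = Suc (length (sub_positions U))"
      using False by (simp add: t_def snoc sub_positions_snoc)
    have W: "even t" "\<forall>k\<in>{1..length W}. entry W k = (D, 1) \<longrightarrow> entry (sub_positions W) (t div 2) < k"
      using assms[unfolded weighted_delannoy_paths_iff Let_def, folded t_def] t by blast+
    \<comment> \<open>\<open>t\<close> is positive because the last step is counted, and it is even.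
      The bound puts \<open>t div 2\<close> into the range of indices and also shows that
      \<open>U\<close> is nonempty.\<close>
    then have "t \<ge> 2" using t by presburger
    then have "0 < entry (sub_positions W) (t div 2)"
      by (intro entry_sub_positions) (auto simp: t_def)
    then have hd: "entry W 1 \<noteq> (D, 1)"
      using W(2) snoc by force
    have "U \<noteq> []" using t \<open>t \<ge> 2\<close> by (auto simp: sub_positions_def)
    then obtain x W' where "U = x # W'" by (cases U) auto
    with hd snoc False show ?thesis by (intro that(2)[of x W' y]) (auto simp: entry_def)
  qed (use snoc that in blast)
qed

text \<open>Mirror labels at the ends of a path of size \<open>Suc n\<close> add up to
  \<open>2 * n + 3\<close>, and both are at least 2, which gives the range of \<open>l\<close>. For
  \<open>n = 0\<close> this range is empty, so the truncated \<open>n - 1\<close> does no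
  harm.\<close>

lemma weighted_delannoy_paths_Suc:
  "weighted_delannoy_paths (Suc n) =
     (\<lambda>W. W @ [(D, 1)]) ` weighted_delannoy_paths n
   \<union> (\<lambda>W. (N, 1) # W @ [(E, 1)]) ` weighted_delannoy_paths n
   \<union> (\<lambda>W. (E, 1) # W @ [(N, 1)]) ` weighted_delannoy_paths n
   \<union> (\<Union>l\<in>{2..2 * n + 1}. (\<lambda>W. (D, l) # W @ [(D, 2 * n + 3 - l)]) ` weighted_delannoy_paths (n - 1))"
  (is "?L = ?R")
proof (intro set_eqI iffI)
  fix W assume W: "W \<in> ?L"
  then show "W \<in> ?R"
  proof (cases rule: weighted_delannoy_paths_cases)
    case (snoc W')
    with W show ?thesis by (auto simp: snoc_D1_in_weighted_delannoy_paths_iff[simplified])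
  next
    case (Cons_snoc x W' y)
    with W have *: "mirror_steps (Suc n) x y" "step_size x \<le> Suc n"
      "W' \<in> weighted_delannoy_paths (Suc n - step_size x)"
      by (simp_all add: Cons_snoc_in_weighted_delannoy_paths_iff)
    from *(1) consider "x = (N, 1)" "y = (E, 1)" | "x = (E, 1)" "y = (N, 1)"
      | l l' where "x = (D, l)" "y = (D, l')" "2 \<le> l" "2 \<le> l'" "l + l' = 2 * Suc n + 1"
      by (auto simp: mirror_steps_def)
    then show ?thesis
    proof cases
      case (3 l l')
      then have "l' = 2 * n + 3 - l" "l \<in> {2..2 * n + 1}" by auto
      with 3 * Cons_snoc show ?thesis by (auto simp: step_size_def)
    qed (use * Cons_snoc in \<open>auto simp: step_size_def\<close>)
  qed
next
  fix W assume "W \<in> ?R"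
  then show "W \<in> ?L"
    by (elim UnE UN_E imageE)
      (auto simp: snoc_D1_in_weighted_delannoy_paths_iff[simplified] mirror_steps_def step_size_def
        Cons_snoc_in_weighted_delannoy_paths_iff[simplified])
qed

lemma card_weighted_delannoy_paths:
  "finite (weighted_delannoy_paths n) \<and> card (weighted_delannoy_paths n) = skew_clan_number n"
proof (induction n rule: less_induct)
  case (less n)
  show ?case
  proof (cases n)
    case 0
    then show ?thesis by (simp add: weighted_delannoy_paths_0)
  next
    case (Suc m)
    have m: "finite (weighted_delannoy_paths m)"
      "card (weighted_delannoy_paths m) = skew_clan_number m"
      and m': "finite (weighted_delannoy_paths (m - 1))"
        "card (weighted_delannoy_paths (m - 1)) = skew_clan_number (m - 1)"
      using less.IH[of m] less.IH[of "m - 1"] Suc by auto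
    let ?diag = "\<lambda>l. (\<lambda>W. (D, l) # W @ [(D, 2 * m + 3 - l)]) ` weighted_delannoy_paths (m - 1)"
    have "card (\<Union>l\<in>{2..2 * m + 1}. ?diag l) = (\<Sum>l\<in>{2..2 * m + 1}. card (?diag l))"
      using m' by (intro card_UN_disjoint) auto
    also have "\<dots> = 2 * m * skew_clan_number (m - 1)"
      using m' by (simp add: card_image inj_on_def)
    finally have diag: "card (\<Union>l\<in>{2..2 * m + 1}. ?diag l) = 2 * m * skew_clan_number (m - 1)" .
    let ?P1 = "(\<lambda>W. W @ [(D, 1)]) ` weighted_delannoy_paths m"
    let ?P2 = "(\<lambda>W. (N, 1) # W @ [(E, 1)]) ` weighted_delannoy_paths m"
    let ?P3 = "(\<lambda>W. (E, 1) # W @ [(N, 1)]) ` weighted_delannoy_paths m"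
    have card: "card ?P1 = skew_clan_number m" "card ?P2 = skew_clan_number m"
      "card ?P3 = skew_clan_number m"
      using m by (simp_all add: card_image inj_on_def)
    \<comment> \<open>The last step separates the first family from the others, since the mirror
      label \<open>2 * m + 3 - l\<close> is at least 2. The other families differ in their first
      steps.\<close>
    have last: "last W = (D, 1)" if "W \<in> ?P1" for W using that by auto
    have "?P1 \<inter> ?P2 = {}" "(?P1 \<union> ?P2) \<inter> ?P3 = {}"
      using last by fastforce+
    moreover have "(?P1 \<union> ?P2 \<union> ?P3) \<inter> (\<Union>l\<in>{2..2 * m + 1}. ?diag l) = {}"
      using last by fastforce
    ultimately have "card (weighted_delannoy_paths (Suc m)) = 3 * skew_clan_number m
      + 2 * m * skew_clan_number (m - 1)"
      unfolding weighted_delannoy_paths_Suc using m m' diag card by (simp add: card_Un_disjoint)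
    moreover have "finite (weighted_delannoy_paths (Suc m))"
      unfolding weighted_delannoy_paths_Suc using m m' by simp
    ultimately show ?thesis by (simp add: Suc)
  qed
qed

section \<open>Signed matchings compatible with an involution\<close>

text \<open>\<open>A\<close> holds the plus signs and \<open>M\<close> the pairs of equal numbers;
  the uncovered points outside \<open>A\<close> are the minus signs. The last condition says that
  \<open>r\<close> exchanges the two signs.\<close>

definition skew_matchings :: "('a \<Rightarrow> 'a) \<Rightarrow> 'a set \<Rightarrow> ('a set \<times> 'a set set) set" where
  "skew_matchings r X = {(A, M). A \<subseteq> X \<and> (\<forall>p\<in>M. p \<subseteq> X \<and> card p = 2) \<and> pairwise disjnt M
     \<and> (\<forall>p\<in>M. r ` p \<in> M) \<and> A \<inter> \<Union>M = {} \<and> (\<forall>x\<in>X - \<Union>M. x \<in> A \<longleftrightarrow> r x \<notin> A)}"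

lemma skew_matchingsI:
  assumes "A \<subseteq> X" "\<And>p. p \<in> M \<Longrightarrow> p \<subseteq> X \<and> card p = 2 \<and> r ` p \<in> M" "pairwise disjnt M"
    "A \<inter> \<Union>M = {}" "\<And>x. x \<in> X - \<Union>M \<Longrightarrow> x \<in> A \<longleftrightarrow> r x \<notin> A"
  shows "(A, M) \<in> skew_matchings r X"
  using assms by (simp add: skew_matchings_def)

lemma skew_matchings_empty: "skew_matchings r {} = {({}, {})}"
  by (auto simp: skew_matchings_def)

text \<open>Prescribing how a signed matching looks on a block \<open>B\<close> closed under \<open>r\<close> leaves an
  arbitrary signed matching on \<open>X - B\<close>.\<close>

definition restricted_skew_matchings where
  "restricted_skew_matchings r X B a m =
     {(A, M). (A, M) \<in> skew_matchings r X \<and> A \<inter> B = a \<and> {p \<in> M. p \<inter> B \<noteq> {}} = m}"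

text \<open>No pair crosses the border of \<open>B\<close>, and \<open>r\<close> preserves both
  \<open>B\<close> and \<open>X - B\<close>. Each condition therefore splits into one on
  \<open>B\<close>, settled by \<open>a\<close> and \<open>m\<close>, and one on
  \<open>X - B\<close>.\<close>

lemma bij_betw_restricted_skew_matchings:
  assumes "B \<subseteq> X" "r ` B \<subseteq> B" and r: "\<And>x. x \<in> X \<Longrightarrow> r (r x) = x" "\<And>x. x \<in> X \<Longrightarrow> r x \<in> X"
    and am: "(a, m) \<in> skew_matchings r B"
  shows "bij_betw (\<lambda>(A, M). (A \<union> a, M \<union> m)) (skew_matchings r (X - B))
    (restricted_skew_matchings r X B a m)"
proof (rule bij_betw_byWitness[where f' = "\<lambda>(A, M). (A - B, M - m)"])
  have rB: "r x \<in> B \<longleftrightarrow> x \<in> B" if "x \<in> X" for x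
    using assms(1,2) r(1)[OF that] by (metis image_subset_iff)
  have a: "a \<subseteq> B" "a \<inter> \<Union>m = {}" and m: "\<And>p. p \<in> m \<Longrightarrow> p \<subseteq> B \<and> card p = 2 \<and> r ` p \<in> m"
    and m': "pairwise disjnt m" and am': "\<And>x. x \<in> B - \<Union>m \<Longrightarrow> x \<in> a \<longleftrightarrow> r x \<notin> a"
    using am by (auto simp: skew_matchings_def)
  show "\<forall>am\<in>skew_matchings r (X - B). (case (case am of (A, M) \<Rightarrow> (A \<union> a, M \<union> m)) of
      (A, M) \<Rightarrow> (A - B, M - m)) = am"
  proof (intro ballI, simp only: split_paired_all prod.case)
    fix A M assume "(A, M) \<in> skew_matchings r (X - B)"
    then have A: "A \<subseteq> X - B" and M: "\<And>p. p \<in> M \<Longrightarrow> p \<subseteq> X - B \<and> card p = 2"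
      by (auto simp: skew_matchings_def)
    have "A \<union> a - B = A" using A a by blast
    \<comment> \<open>A common pair would lie both inside and outside \<open>B\<close> and so be
      empty.\<close>
    moreover have "p \<notin> m" if "p \<in> M" for p
    proof
      assume "p \<in> m"
      with M[OF that] m[of p] have "p = {}" by blast
      with M[OF that] show False by simp
    qed
    then have "M \<union> m - m = M" by blast
    ultimately show "(A \<union> a - B, M \<union> m - m) = (A, M)" by simp
  qed
  show "\<forall>am\<in>restricted_skew_matchings r X B a m. (case (case am of (A, M) \<Rightarrow> (A - B, M - m)) of
      (A, M) \<Rightarrow> (A \<union> a, M \<union> m)) = am"
    by (auto simp: restricted_skew_matchings_def)
  show "(\<lambda>(A, M). (A \<union> a, M \<union> m)) ` skew_matchings r (X - B) \<subseteq> restricted_skew_matchings r X B a m"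
  proof (intro image_subsetI, simp only: split_paired_all prod.case)
    fix A M assume "(A, M) \<in> skew_matchings r (X - B)"
    then have A: "A \<subseteq> X - B" "A \<inter> \<Union>M = {}"
      and M: "\<And>p. p \<in> M \<Longrightarrow> p \<subseteq> X - B \<and> card p = 2 \<and> r ` p \<in> M" and M': "pairwise disjnt M"
      and AM: "\<And>x. x \<in> X - B - \<Union>M \<Longrightarrow> x \<in> A \<longleftrightarrow> r x \<notin> A"
      by (auto simp: skew_matchings_def)
    have blocks: "p \<subseteq> X \<and> card p = 2 \<and> r ` p \<in> M \<union> m" if "p \<in> M \<union> m" for p
      using that M m assms(1) by blast
    have "pairwise disjnt (M \<union> m)"
      using M m M' m' unfolding pairwise_def disjnt_def by blast
    moreover have "(A \<union> a) \<inter> \<Union>(M \<union> m) = {}"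
      using A M a m by blast
    moreover have "x \<in> A \<union> a \<longleftrightarrow> r x \<notin> A \<union> a" if x: "x \<in> X - \<Union>(M \<union> m)" for x
    proof (cases "x \<in> B")
      case True
      with x A(1) am' rB[of x] show ?thesis by blast
    next
      case False
      with x a(1) AM rB[of x] show ?thesis by blast
    qed
    moreover have "A \<union> a \<subseteq> X" using A a assms(1) by blast
    ultimately have "(A \<union> a, M \<union> m) \<in> skew_matchings r X"
      using blocks by (intro skew_matchingsI) blast+
    moreover have "(A \<union> a) \<inter> B = a" using A a by blast
    moreover have "{p \<in> M \<union> m. p \<inter> B \<noteq> {}} = m"
    proof -
      have "p \<inter> B = {}" if "p \<in> M" for p using M[OF that] by blast
      moreover have "p \<inter> B \<noteq> {}" if "p \<in> m" for p using m[OF that] by (auto simp: card_2_iff)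
      ultimately show ?thesis by blast
    qed
    ultimately show "(A \<union> a, M \<union> m) \<in> restricted_skew_matchings r X B a m"
      by (simp add: restricted_skew_matchings_def)
  qed
  show "(\<lambda>(A, M). (A - B, M - m)) ` restricted_skew_matchings r X B a m \<subseteq> skew_matchings r (X - B)"
  proof (intro image_subsetI, simp only: split_paired_all prod.case)
    fix A M assume AMr: "(A, M) \<in> restricted_skew_matchings r X B a m"
    then have AB: "A \<inter> B = a" and MB: "{p \<in> M. p \<inter> B \<noteq> {}} = m" and A: "A \<subseteq> X" "A \<inter> \<Union>M = {}"
      and M: "\<And>p. p \<in> M \<Longrightarrow> p \<subseteq> X \<and> card p = 2 \<and> r ` p \<in> M" and M': "pairwise disjnt M"
      and AM: "\<And>x. x \<in> X - \<Union>M \<Longrightarrow> x \<in> A \<longleftrightarrow> r x \<notin> A"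
      by (auto simp: skew_matchings_def restricted_skew_matchings_def)
    \<comment> \<open>\<open>m\<close> collects all pairs of \<open>M\<close> that meet
      \<open>B\<close>, so \<open>p\<close> avoids \<open>B\<close>. Its image avoids
      \<open>B\<close> as well and cannot belong to \<open>m\<close>.\<close>
    have "p \<subseteq> X - B \<and> card p = 2 \<and> r ` p \<in> M - m" if "p \<in> M - m" for p
    proof -
      have "p \<inter> B = {}" "p \<subseteq> X" using that MB M by blast+
      then have "r ` p \<inter> B = {}" using rB by blast
      with that M MB \<open>p \<inter> B = {}\<close> show ?thesis by blast
    qed
    moreover have "x \<in> A - B \<longleftrightarrow> r x \<notin> A - B" if "x \<in> X - B - \<Union>(M - m)" for x
    proof -
      have "x \<in> X - \<Union>M" using that m by blast
      with AM that rB show ?thesis by blast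
    qed
    moreover have "pairwise disjnt (M - m)" using M' by (rule pairwise_subset) auto
    moreover have "A - B \<subseteq> X - B" "(A - B) \<inter> \<Union>(M - m) = {}" using A by blast+
    ultimately show "(A - B, M - m) \<in> skew_matchings r (X - B)"
      by (intro skew_matchingsI) blast+
  qed
qed

section \<open>The recurrence for signed matchings\<close>

lemma restricted_skew_matchings_disjoint:
  "a \<noteq> a' \<or> m \<noteq> m' \<Longrightarrow>
    restricted_skew_matchings r X B a m \<inter> restricted_skew_matchings r X B a' m' = {}"
  by (auto simp: restricted_skew_matchings_def)

text \<open>The classes record what happens at \<open>x\<close>, on the smallest block closed under
  \<open>r\<close> that contains \<open>x\<close> and its partner, if there is one.\<close>

lemma skew_matchings_split:
  assumes r: "\<And>x. x \<in> X \<Longrightarrow> r (r x) = x" "\<And>x. x \<in> X \<Longrightarrow> r x \<in> X"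
    and x: "x \<in> X"
  shows "skew_matchings r X =
     restricted_skew_matchings r X {x, r x} {x} {}
   \<union> restricted_skew_matchings r X {x, r x} {r x} {}
   \<union> restricted_skew_matchings r X {x, r x} {} {{x, r x}}
   \<union> (\<Union>y\<in>X - {x, r x}. restricted_skew_matchings r X {x, r x, y, r y} {} {{x, y}, {r x, r y}})"
  (is "?L = ?R")
proof
  show "?R \<subseteq> ?L" by (auto simp: restricted_skew_matchings_def)
  show "?L \<subseteq> ?R"
  proof (rule subsetI, simp only: split_paired_all)
    fix A M assume AMX: "(A, M) \<in> skew_matchings r X"
    then have A: "A \<subseteq> X" "A \<inter> \<Union>M = {}"
      and M: "\<And>p. p \<in> M \<Longrightarrow> p \<subseteq> X \<and> card p = 2 \<and> r ` p \<in> M" and M': "pairwise disjnt M"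
      and AM: "\<And>x. x \<in> X - \<Union>M \<Longrightarrow> x \<in> A \<longleftrightarrow> r x \<notin> A"
      by (auto simp: skew_matchings_def)
    have uniq: "p = q" if "p \<in> M" "q \<in> M" "z \<in> p" "z \<in> q" for p q z
      using M' that unfolding pairwise_def disjnt_def by blast
    have rM: "r ` p \<in> M" if "p \<in> M" for p using M that by blast
    show "(A, M) \<in> ?R"
    proof (cases "x \<in> \<Union>M")
      case False
      \<comment> \<open>A pair containing \<open>r x\<close> would have an image under
        \<open>r\<close> that is a pair containing \<open>x\<close>.\<close>
      then have "r x \<notin> \<Union>M" using M r(1)[OF x] by (metis UnionE UnionI imageI)
      then have "{p \<in> M. p \<inter> {x, r x} \<noteq> {}} = {}" using False by blast
      moreover have "A \<inter> {x, r x} = {x} \<or> A \<inter> {x, r x} = {r x}"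
        using AM[of x] False x by blast
      ultimately show ?thesis using AMX unfolding restricted_skew_matchings_def by blast
    next
      case True
      then obtain p where p: "p \<in> M" "x \<in> p" by blast
      then obtain y where y: "p = {x, y}" "y \<noteq> x"
        using M[of p] by (auto simp: card_2_iff)
      have yX: "y \<in> X" using M p y by blast
      have rp: "{r x, r y} \<in> M" using rM[OF p(1)] y by simp
      show ?thesis
      proof (cases "y = r x")
        case True
        then have "{p \<in> M. p \<inter> {x, r x} \<noteq> {}} = {{x, r x}}" "A \<inter> {x, r x} = {}"
          using uniq[OF p(1)] p y A by blast+
        then show ?thesis using AMX unfolding restricted_skew_matchings_def by blast
      next
        case False
        have xy: "{x, y} \<in> M" using p y by simp
        have "q = {x, y} \<or> q = {r x, r y}" if "q \<in> M" "q \<inter> {x, r x, y, r y} \<noteq> {}" for q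
        proof -
          from that(2) obtain z where "z \<in> q" "z \<in> {x, y} \<or> z \<in> {r x, r y}" by blast
          then show ?thesis using uniq[OF that(1) xy] uniq[OF that(1) rp] by blast
        qed
        then have "{p \<in> M. p \<inter> {x, r x, y, r y} \<noteq> {}} = {{x, y}, {r x, r y}}"
          using xy rp by blast
        moreover have "A \<inter> {x, r x, y, r y} = {}" using A(2) xy rp by blast
        ultimately have "(A, M) \<in> restricted_skew_matchings r X {x, r x, y, r y} {} {{x, y}, {r x, r y}}"
          using AMX unfolding restricted_skew_matchings_def by blast
        then show ?thesis using False y(2) yX by blast
      qed
    qed
  qed
qed

lemma card_skew_matchings:
  assumes "finite X" "card X = 2 * n" "\<And>x. x \<in> X \<Longrightarrow> r (r x) = x" "\<And>x. x \<in> X \<Longrightarrow> r x \<in> X"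
    "\<And>x. x \<in> X \<Longrightarrow> r x \<noteq> x"
  shows "finite (skew_matchings r X) \<and> card (skew_matchings r X) = skew_clan_number n"
  using assms
proof (induction n arbitrary: X rule: less_induct)
  case (less n)
  note r = less.prems(3-5)
  show ?case
  proof (cases n)
    case 0
    with less.prems have "X = {}" by simp
    then show ?thesis by (simp add: skew_matchings_empty 0)
  next
    case (Suc m)
    with less.prems obtain x where x: "x \<in> X" by fastforce
    let ?F = "restricted_skew_matchings r X"
    have r_eq: "r u = v \<longleftrightarrow> r v = u" if "u \<in> X" "v \<in> X" for u v
      using r that by blast
    \<comment> \<open>Treats all kinds of blocks at once: \<open>k = m\<close> for blocks of two
      points and \<open>k = m - 1\<close> for blocks of four.\<close>
    have step: "finite (?F B a q) \<and> card (?F B a q) = skew_clan_number k"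
      if B: "B \<subseteq> X" "card B = 2 * (n - k)" "k < n" "r ` B \<subseteq> B" and "(a, q) \<in> skew_matchings r B"
        for B a q k
    proof -
      have "finite (skew_matchings r (X - B)) \<and> card (skew_matchings r (X - B))
        = skew_clan_number k"
      proof (rule less.IH)
        have "finite B" using B less.prems(1) finite_subset by blast
        then show "card (X - B) = 2 * k"
          using B less.prems(1,2) by (simp add: card_Diff_subset)
        show "r y \<in> X - B" if "y \<in> X - B" for y
          using that B(4) r(1)[of y] r(2)[of y] by (metis DiffE DiffI image_subset_iff)
      qed (use B less.prems in auto)
      moreover note bij_betw_restricted_skew_matchings[OF B(1,4) r(1,2) that(5)]
      ultimately show ?thesis by (metis bij_betw_finite bij_betw_same_card)
    qed
    have xr: "x \<noteq> r x" "r x \<in> X" "r (r x) = x" using r x by metis+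
    have F1: "finite (?F {x, r x} {x} {}) \<and> card (?F {x, r x} {x} {}) = skew_clan_number m"
      using x xr Suc by (intro step) (auto simp: skew_matchings_def)
    have F2: "finite (?F {x, r x} {r x} {}) \<and> card (?F {x, r x} {r x} {}) = skew_clan_number m"
      using x xr Suc by (intro step) (auto simp: skew_matchings_def)
    have F3: "finite (?F {x, r x} {} {{x, r x}})
      \<and> card (?F {x, r x} {} {{x, r x}}) = skew_clan_number m"
      using x xr Suc by (intro step) (auto simp: skew_matchings_def)
    define G where "G = (\<lambda>y. ?F {x, r x, y, r y} {} {{x, y}, {r x, r y}})"
    have cardX: "card (X - {x, r x}) = 2 * m"
      using less.prems(1,2) x xr Suc by (simp add: card_Diff_subset)
    have G: "finite (G y) \<and> card (G y) = skew_clan_number (m - 1)" if y: "y \<in> X - {x, r x}" for y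
    proof -
      \<comment> \<open>Since \<open>y\<close> exists, \<open>m - 1\<close> is not truncated, and
        the block has \<open>2 * (Suc m - (m - 1)) = 4\<close> points; \<open>yr\<close> makes them
        distinct.\<close>
      have "m > 0" using cardX y less.prems(1) by (cases m) auto
      have yr: "r y \<in> X" "r (r y) = y" "r y \<noteq> y" "r y \<noteq> x" "r y \<noteq> r x"
        using r[of y] y r_eq[OF x, of y] xr by auto
      show ?thesis
        unfolding G_def
        using x xr y yr Suc \<open>m > 0\<close>
        by (intro step) (auto simp: skew_matchings_def pairwise_def disjnt_def)
    qed
    have "card (\<Union>y\<in>X - {x, r x}. G y) = (\<Sum>y\<in>X - {x, r x}. card (G y))"
    proof (rule card_UN_disjoint)
      show "\<forall>y\<in>X - {x, r x}. \<forall>z\<in>X - {x, r x}. y \<noteq> z \<longrightarrow> G y \<inter> G z = {}"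
      proof (intro ballI impI equals0I)
        fix y z AM assume yz: "y \<in> X - {x, r x}" "z \<in> X - {x, r x}" "y \<noteq> z" "AM \<in> G y \<inter> G z"
        obtain A M where AM: "AM = (A, M)" by (cases AM)
        \<comment> \<open>Two pairs of one matching that share \<open>x\<close> coincide, which
          forces \<open>y = z\<close>.\<close>
        with yz have "pairwise disjnt M" "{x, y} \<in> M" "{x, z} \<in> M"
          by (auto simp: G_def restricted_skew_matchings_def skew_matchings_def)
        then have "{x, y} = {x, z}"
          using pairwiseD[of disjnt M "{x, y}" "{x, z}"] by (auto simp: disjnt_def)
        with yz show False by (auto simp: doubleton_eq_iff)
      qed
    qed (use less.prems(1) G in auto)
    also have "\<dots> = 2 * m * skew_clan_number (m - 1)" using G cardX by simp
    finally have cardG: "card (\<Union>y\<in>X - {x, r x}. G y) = 2 * m * skew_clan_number (m - 1)" .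
    have finG: "finite (\<Union>y\<in>X - {x, r x}. G y)" using G less.prems(1) by blast
    have d1: "?F {x, r x} {x} {} \<inter> ?F {x, r x} {r x} {} = {}"
      and d2: "(?F {x, r x} {x} {} \<union> ?F {x, r x} {r x} {}) \<inter> ?F {x, r x} {} {{x, r x}} = {}"
      using xr(1) by (simp_all add: Int_Un_distrib2 restricted_skew_matchings_disjoint)
    \<comment> \<open>In the first three classes no pair other than \<open>{x, r x}\<close> meets
      \<open>{x, r x}\<close>, whereas a member of \<open>G y\<close> contains \<open>{x, y}\<close>
      with \<open>y\<close> different from \<open>r x\<close>.\<close>
    have d3: "(?F {x, r x} {x} {} \<union> ?F {x, r x} {r x} {} \<union> ?F {x, r x} {} {{x, r x}}) \<inter>
      (\<Union>y\<in>X - {x, r x}. G y) = {}"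
    proof (rule equals0I)
      fix AM assume "AM \<in> (?F {x, r x} {x} {} \<union> ?F {x, r x} {r x} {} \<union> ?F {x, r x} {} {{x, r x}}) \<inter>
        (\<Union>y\<in>X - {x, r x}. G y)"
      moreover obtain A M where "AM = (A, M)" by (cases AM)
      ultimately obtain y where y: "y \<in> X - {x, r x}" and "(A, M) \<in> G y"
        and M: "{p \<in> M. p \<inter> {x, r x} \<noteq> {}} \<subseteq> {{x, r x}}"
        by (auto simp: restricted_skew_matchings_def)
      then have "{x, y} \<in> M" by (auto simp: G_def restricted_skew_matchings_def)
      with M have "{x, y} = {x, r x}" by blast
      with y show False by (auto simp: doubleton_eq_iff)
    qed
    have split: "skew_matchings r X = ?F {x, r x} {x} {} \<union> ?F {x, r x} {r x} {}
        \<union> ?F {x, r x} {} {{x, r x}} \<union> (\<Union>y\<in>X - {x, r x}. G y)"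
      unfolding G_def using r(1,2) x by (rule skew_matchings_split)
    have "card (skew_matchings r X) = 3 * skew_clan_number m + 2 * m * skew_clan_number (m - 1)"
      unfolding split
      using F1 F2 F3 finG cardG d1 d2 d3 by (simp add: card_Un_disjoint)
    moreover have "finite (skew_matchings r X)"
      unfolding split
      using F1 F2 F3 finG by blast
    ultimately show ?thesis by (simp add: Suc)
  qed
qed

section \<open>Skew-symmetric clans as signed matchings\<close>

lemma count_list_eq_card_positions: "count_list c s = card (positions s c)"
  by (simp add: count_list_eq_length_filter length_filter_conv_card positions_def eq_commute)

lemma card_positions_Num:
  "c \<in> clan_strings n \<Longrightarrow> Num k \<in> set c \<Longrightarrow> card (positions (Num k) c) = 2"
  by (simp add: clan_strings_def count_list_eq_card_positions)

text \<open>A number occurs exactly twice, so two positions that carry it exhaust its set of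
  positions.\<close>

lemma matching_pairs_eq:
  assumes "c \<in> clan_strings n"
  shows "matching_pairs c = (\<lambda>k. positions (Num k) c) ` {k. Num k \<in> set c}"
proof (intro set_eqI iffI)
  fix S assume "S \<in> matching_pairs c"
  then obtain i j k where S: "S = {i, j}" "i < j" "j < length c" "c ! i = Num k" "c ! j = Num k"
    by (auto simp: matching_pairs_def)
  then have k: "Num k \<in> set c" by (metis nth_mem)
  have "S \<subseteq> positions (Num k) c" "card S = 2" "finite (positions (Num k) c)"
    using S by (auto simp: positions_def)
  then have "S = positions (Num k) c"
    using card_positions_Num[OF assms k] by (intro card_subset_eq) auto
  with k show "S \<in> (\<lambda>k. positions (Num k) c) ` {k. Num k \<in> set c}" by blast
next
  fix S assume "S \<in> (\<lambda>k. positions (Num k) c) ` {k. Num k \<in> set c}"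
  then obtain k where k: "Num k \<in> set c" "S = positions (Num k) c" by blast
  then obtain i j where "S = {i, j}" "i < j"
    using card_positions_Num[OF assms k(1)] by (metis card_2_iff insert_commute linorder_neqE_nat)
  moreover from this k have "c ! i = Num k" "c ! j = Num k" "j < length c"
    by (auto simp: positions_def)
  ultimately show "S \<in> matching_pairs c" by (auto simp: matching_pairs_def)
qed

lemma Union_matching_pairs:
  assumes "c \<in> clan_strings n"
  shows "\<Union>(matching_pairs c) = {..<2 * n} - positions Plus c - positions Minus c"
proof -
  have "length c = 2 * n" using assms by (simp add: clan_strings_def)
  then have "i \<in> \<Union>(matching_pairs c) \<longleftrightarrow> i < 2 * n \<and> (\<exists>k. c ! i = Num k)" for i
    unfolding matching_pairs_eq[OF assms] by (auto simp: positions_def) (metis nth_mem)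
  moreover have "(\<exists>k. s = Num k) \<longleftrightarrow> s \<noteq> Plus \<and> s \<noteq> Minus" for s
    by (cases s) auto
  ultimately show ?thesis using \<open>length c = 2 * n\<close> by (auto simp: positions_def)
qed

text \<open>A complete invariant of the clan of a string: the minus signs are recovered as the
  remaining positions.\<close>

definition signed_matching :: "clan_symbol list \<Rightarrow> nat set \<times> nat set set" where
  "signed_matching c = (positions Plus c, matching_pairs c)"

lemma positions_Minus:
  assumes "c \<in> clan_strings n"
  shows "positions Minus c = {..<2 * n} - positions Plus c - \<Union>(matching_pairs c)"
  using assms unfolding Union_matching_pairs[OF assms]
    by (auto simp: positions_def clan_strings_def)

lemma clan_rel_iff_signed_matching:
  "(c, c') \<in> clan_rel n \<longleftrightarrow>
     c \<in> clan_strings n \<and> c' \<in> clan_strings n \<and> signed_matching c = signed_matching c'"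
  by (auto simp: clan_rel_def signed_matching_def positions_Minus)

text \<open>Reversal and negation send the minus positions to plus positions and reflect all pairs.
  Invariance thus says that \<open>A\<close> is the reflection of the minus positions and that
  \<open>M\<close> is its own reflection.\<close>

lemma skew_string_iff:
  assumes "c \<in> clan_strings n"
  shows "signed_matching (map neg_symbol (rev c)) = signed_matching c \<longleftrightarrow>
    signed_matching c \<in> skew_matchings (\<lambda>i. 2 * n - Suc i) {..<2 * n}"
proof -
  let ?r = "\<lambda>i. 2 * n - Suc i" and ?X = "{..<2 * n}"
  define A M where "A = positions Plus c" and "M = matching_pairs c"
  have len: "length c = 2 * n" using assms by (simp add: clan_strings_def)
  have r: "?r (?r i) = i" "?r i \<in> ?X" if "i \<in> ?X" for i using that by auto
  have A: "A \<subseteq> ?X" "A \<inter> \<Union>M = {}"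
    unfolding A_def M_def Union_matching_pairs[OF assms] using len by (auto simp: positions_def)
  have M: "p \<subseteq> ?X" "card p = 2" if "p \<in> M" for p
    using that card_positions_Num[OF assms] len unfolding M_def matching_pairs_eq[OF assms]
    by (auto simp: positions_def)
  have M': "pairwise disjnt M"
    unfolding M_def matching_pairs_eq[OF assms]
      by (auto simp: pairwise_def disjnt_def positions_def)
  have "signed_matching (map neg_symbol (rev c)) = (?r ` (?X - A - \<Union>M), (`) ?r ` M)"
    by (simp add: signed_matching_def positions_neg_rev matching_pairs_neg_rev len positions_Minus[OF assms] A_def M_def)
  moreover have "signed_matching c = (A, M)" by (simp add: signed_matching_def A_def M_def)
  moreover have "(?r ` (?X - A - \<Union>M), (`) ?r ` M) = (A, M) \<longleftrightarrow> (A, M) \<in> skew_matchings ?r ?X"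
  proof
    assume eq: "(?r ` (?X - A - \<Union>M), (`) ?r ` M) = (A, M)"
    then have rM: "?r ` p \<in> M" if "p \<in> M" for p using that by blast
    have "x \<in> A \<longleftrightarrow> ?r x \<notin> A" if x: "x \<in> ?X - \<Union>M" for x
    proof
      assume "x \<in> A"
      then obtain y where "y \<in> ?X - A - \<Union>M" "x = ?r y" using eq by blast
      then show "?r x \<notin> A" using r by simp
    next
      assume "?r x \<notin> A"
      show "x \<in> A"
      proof (rule ccontr)
        assume "x \<notin> A"
        then have "?r x \<in> ?r ` (?X - A - \<Union>M)" using x by blast
        with eq \<open>?r x \<notin> A\<close> show False by simp
      qed
    qed
    then show "(A, M) \<in> skew_matchings ?r ?X"
      using A M M' rM by (simp add: skew_matchings_def)
  next
    assume "(A, M) \<in> skew_matchings ?r ?X"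
    then have rM: "\<And>p. p \<in> M \<Longrightarrow> ?r ` p \<in> M" and rA: "\<And>x. x \<in> ?X - \<Union>M \<Longrightarrow> x \<in> A \<longleftrightarrow> ?r x \<notin> A"
      by (auto simp: skew_matchings_def)
    have rr: "?r ` ?r ` p = p" if "p \<subseteq> ?X" for p
    proof -
      have "(\<lambda>x. ?r (?r x)) ` p = id ` p" using that r by (intro image_cong) auto
      then show ?thesis by (simp add: image_image)
    qed
    \<comment> \<open>Closure of \<open>M\<close> under the reflection already gives equality with
      its image, because reflecting twice is the identity.\<close>
    have "p \<in> (`) ?r ` M" if "p \<in> M" for p
      using rM[OF that] rr[OF M(1)[OF that]] by (metis imageI)
    then have "(`) ?r ` M = M" using rM by blast
    \<comment> \<open>A pair through the mirror image of \<open>x\<close> would reflect to a pair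
      through \<open>x\<close>.\<close>
    moreover have nM: "?r x \<in> ?X - \<Union>M" if x: "x \<in> ?X - \<Union>M" for x
    proof -
      have "?r x \<notin> p" if "p \<in> M" for p
      proof
        assume "?r x \<in> p"
        then have "?r (?r x) \<in> ?r ` p" by (rule imageI)
        then show False using r x rM[OF that] by auto
      qed
      then show ?thesis using x by auto
    qed
    have "?r ` (?X - A - \<Union>M) = A"
    proof
      show "?r ` (?X - A - \<Union>M) \<subseteq> A" using rA by blast
      show "A \<subseteq> ?r ` (?X - A - \<Union>M)"
      proof
        fix x assume x: "x \<in> A"
        then have "x \<in> ?X - \<Union>M" using A by blast
        with nM[of x] rA[of x] x have "?r x \<in> ?X - A - \<Union>M" "x = ?r (?r x)" using r(1) by auto
        then show "x \<in> ?r ` (?X - A - \<Union>M)" by blast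
      qed
    qed
    ultimately show "(?r ` (?X - A - \<Union>M), (`) ?r ` M) = (A, M)" by simp
  qed
  ultimately show ?thesis by simp
qed

text \<open>Naming each pair by its least element gives different names to different pairs, since
  pairs are disjoint. The numbers of plus and minus signs agree because the reflection exchanges the
  two sets.\<close>

lemma signed_matching_surj:
  assumes "(A, M) \<in> skew_matchings (\<lambda>i. 2 * n - Suc i) {..<2 * n}"
  shows "\<exists>c \<in> clan_strings n. signed_matching c = (A, M)"
proof -
  let ?r = "\<lambda>i. 2 * n - Suc i" and ?X = "{..<2 * n}"
  have A: "A \<subseteq> ?X" "A \<inter> \<Union>M = {}"
    and M: "\<And>p. p \<in> M \<Longrightarrow> p \<subseteq> ?X \<and> card p = 2 \<and> ?r ` p \<in> M" and M': "pairwise disjnt M"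
    and AM: "\<And>x. x \<in> ?X - \<Union>M \<Longrightarrow> x \<in> A \<longleftrightarrow> ?r x \<notin> A"
    using assms by (auto simp: skew_matchings_def)
  have uniq: "p = q" if "p \<in> M" "q \<in> M" "z \<in> p" "z \<in> q" for p q z
    using M' that unfolding pairwise_def disjnt_def by blast
  have Min: "Min p \<in> p" if "p \<in> M" for p
    using M[OF that] by (intro Min_in) (auto simp: card_2_iff)
  \<comment> \<open>At most one pair contains \<open>i\<close>, so for a covered \<open>i\<close>
    the inner union is just that pair.\<close>
  define c where "c = map (\<lambda>i. if i \<in> A then Plus else if i \<in> \<Union>M then Num (Min (\<Union>{p \<in> M. i \<in> p}))
    else Minus) [0..<2 * n]"
  have len: "length c = 2 * n" by (simp add: c_def)
  have c_M: "c ! i = Num (Min p)" if "i \<in> p" "p \<in> M" for i p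
  proof -
    have "{q \<in> M. i \<in> q} = {p}" using that uniq by blast
    moreover have "i < 2 * n" "i \<notin> A" "i \<in> \<Union>M" using that M A by auto
    ultimately show ?thesis by (simp add: c_def)
  qed
  have c_A: "c ! i = Plus" if "i \<in> A" for i using that A by (auto simp: c_def)
  have c_Minus: "c ! i = Minus" if "i \<in> ?X - A - \<Union>M" for i using that by (auto simp: c_def)
  have plus: "positions Plus c = A"
  proof -
    have "i \<in> A" if "i < 2 * n" "c ! i = Plus" for i
      using that c_M[of i] c_Minus[of i] by (cases "i \<in> \<Union>M") auto
    then show ?thesis using c_A A by (auto simp: positions_def len)
  qed
  have minus: "positions Minus c = ?X - A - \<Union>M"
  proof -
    have "i \<in> ?X - A - \<Union>M" if "i < 2 * n" "c ! i = Minus" for i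
      using that c_M[of i] c_A[of i] by auto
    then show ?thesis using c_Minus by (auto simp: positions_def len)
  qed
  have Num: "\<exists>p\<in>M. i \<in> p \<and> k = Min p" if "i < 2 * n" "c ! i = Num k" for i k
    using that c_M[of i] c_A[of i] c_Minus[of i] by (cases "i \<in> \<Union>M"; cases "i \<in> A") auto
  have pos: "positions (Num (Min p)) c = p" if p: "p \<in> M" for p
  proof -
    have "i \<in> p" if i: "i < 2 * n" "c ! i = Num (Min p)" for i
    proof -
      \<comment> \<open>Pairs with equal minima share that element and hence coincide.\<close>
      obtain q where "q \<in> M" "i \<in> q" "Min p = Min q" using Num[OF i] by blast
      then show ?thesis using uniq[OF p \<open>q \<in> M\<close>, of "Min p"] Min p by metis
    qed
    then show ?thesis using c_M[OF _ p] M[OF p] by (auto simp: positions_def len)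
  qed
  have nums: "Num k \<in> set c \<longleftrightarrow> k \<in> Min ` M" for k
  proof
    show "k \<in> Min ` M" if "Num k \<in> set c"
    proof -
      from that obtain i where "i < 2 * n" "c ! i = Num k" by (auto simp: in_set_conv_nth len)
      then show ?thesis using Num by blast
    qed
    show "Num k \<in> set c" if "k \<in> Min ` M"
    proof -
      from that obtain p where p: "p \<in> M" "k = Min p" by blast
      then have "c ! Min p = Num k" "Min p < length c"
        using c_M Min[OF p(1)] M[OF p(1)] len by auto
      then show ?thesis by (metis nth_mem)
    qed
  qed
  have "bij_betw ?r (?X - A - \<Union>M) A"
  proof -
    have nM: "?r x \<notin> \<Union>M" if x: "x \<in> ?X - \<Union>M" for x
    proof
      assume "?r x \<in> \<Union>M"
      then obtain p where "p \<in> M" "?r x \<in> p" by blast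
      then have "?r (?r x) \<in> \<Union>M" using M by blast
      then show False using x by auto
    qed
    show ?thesis
    proof (rule bij_betw_byWitness[where f' = ?r])
      show "?r ` (?X - A - \<Union>M) \<subseteq> A" using AM by blast
      show "?r ` A \<subseteq> ?X - A - \<Union>M"
      proof
        fix y assume "y \<in> ?r ` A"
        then obtain x where x: "x \<in> A" "y = ?r x" by blast
        then have "x \<in> ?X - \<Union>M" using A by blast
        with nM[OF this] AM[OF this] x show "y \<in> ?X - A - \<Union>M" by auto
      qed
    qed (use A in auto)
  qed
  then have "card (?X - A - \<Union>M) = card A" by (rule bij_betw_same_card)
  then have c: "c \<in> clan_strings n"
    using M by (auto simp: clan_strings_def len count_list_eq_card_positions plus minus nums pos)
  moreover have "matching_pairs c = M"
    by (simp add: matching_pairs_eq[OF c] nums image_image pos cong: image_cong_simp)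
  ultimately show ?thesis by (intro bexI[of _ c]) (simp_all add: signed_matching_def plus)
qed

text \<open>All strings with signed matching \<open>S\<close> form a single class, so the map needs
  no choice of a representative.\<close>

lemma bij_betw_signed_matching:
  "bij_betw (\<lambda>S. clan_rel n `` {c \<in> clan_strings n. signed_matching c = S})
     (skew_matchings (\<lambda>i. 2 * n - Suc i) {..<2 * n}) (skew_symmetric_clans n)"
proof -
  let ?T = "skew_matchings (\<lambda>i. 2 * n - Suc i) {..<2 * n}"
  let ?g = "\<lambda>S. clan_rel n `` {c \<in> clan_strings n. signed_matching c = S}"
  have g: "?g (signed_matching c) = clan_rel n `` {c}" if "c \<in> clan_strings n" for c
    using that by (auto simp: clan_rel_iff_signed_matching)
  have skew: "clan_rel n `` {c} \<in> skew_symmetric_clans n \<longleftrightarrow> signed_matching c \<in> ?T"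
    if c: "c \<in> clan_strings n" for c
  proof -
    \<comment> \<open>Equality of classes amounts to relatedness of representatives, so
      skew-symmetry can be tested on one string.\<close>
    have "clan_rel n `` {c} = neg_clan (rev_clan (clan_rel n `` {c})) \<longleftrightarrow>
        (c, map neg_symbol (rev c)) \<in> clan_rel n"
      unfolding neg_rev_clan_class
      using eq_equiv_class_iff[OF equiv_clan_rel c neg_rev_in_clan_strings[OF c]] by simp
    also have "\<dots> \<longleftrightarrow> signed_matching c \<in> ?T"
      using c neg_rev_in_clan_strings[OF c] skew_string_iff[OF c]
      by (auto simp: clan_rel_iff_signed_matching)
    finally show ?thesis using c by (auto simp: skew_symmetric_clans_def clans_def quotientI)
  qed
  show ?thesis
  proof (rule bij_betw_imageI)
    show "inj_on ?g ?T"
    proof (rule inj_onI)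
      fix S S' assume "S \<in> ?T" "S' \<in> ?T" and eq: "?g S = ?g S'"
      then obtain c c' where c: "c \<in> clan_strings n" "signed_matching c = S"
        "c' \<in> clan_strings n" "signed_matching c' = S'"
        by (metis signed_matching_surj surj_pair)
      then have "clan_rel n `` {c} = clan_rel n `` {c'}" using eq g by blast
      then have "(c, c') \<in> clan_rel n" using eq_equiv_class_iff[OF equiv_clan_rel c(1,3)] by blast
      then show "S = S'" using c by (simp add: clan_rel_iff_signed_matching)
    qed
    show "?g ` ?T = skew_symmetric_clans n"
    proof (intro equalityI subsetI)
      fix C assume "C \<in> ?g ` ?T"
      then obtain S where "S \<in> ?T" "C = ?g S" by blast
      moreover from this obtain c where "c \<in> clan_strings n" "signed_matching c = S"
        by (metis signed_matching_surj surj_pair)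
      ultimately show "C \<in> skew_symmetric_clans n" using g skew by metis
    next
      fix C assume C: "C \<in> skew_symmetric_clans n"
      then have "C \<in> clan_strings n // clan_rel n"
        unfolding skew_symmetric_clans_def clans_def by blast
      then obtain c where c: "c \<in> clan_strings n" "C = clan_rel n `` {c}" by (rule quotientE)
      have "C = ?g (signed_matching c)" using g[OF c(1)] c(2) by simp
      moreover have "signed_matching c \<in> ?T" using C skew[OF c(1)] c(2) by simp
      ultimately show "C \<in> ?g ` ?T" by (rule image_eqI)
    qed
  qed
qed

lemma card_skew_symmetric_clans:
  "finite (skew_symmetric_clans n) \<and> card (skew_symmetric_clans n) = skew_clan_number n"
proof -
  have "finite (skew_matchings (\<lambda>i. 2 * n - Suc i) {..<2 * n}) \<and>
      card (skew_matchings (\<lambda>i. 2 * n - Suc i) {..<2 * n}) = skew_clan_number n"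
  proof (rule card_skew_matchings)
    fix i assume "i \<in> {..<2 * n}"
    \<comment> \<open>A fixed point would give \<open>2 * i + 1 = 2 * n\<close>, against
      parity.\<close>
    then show "2 * n - Suc i \<noteq> i" by simp presburger
  qed auto
  then show ?thesis
    using bij_betw_finite[OF bij_betw_signed_matching, of n]
      bij_betw_same_card[OF bij_betw_signed_matching, of n] by simp
qed

theorem theorem4p2:
  fixes n :: nat
  assumes "n \<ge> 1"
  shows "(\<exists>f. bij_betw f (weighted_delannoy_paths n) (skew_symmetric_clans n))
       \<and> finite (skew_symmetric_clans n)
       \<and> finite (weighted_delannoy_paths n)
       \<and> Z n = card (weighted_delannoy_paths n)"
  \<comment> \<open>Both sets are finite with \<open>skew_clan_number n\<close> elements; the
    bijection comes from this equality and not from an explicit map.\<close>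
  using card_weighted_delannoy_paths[of n] card_skew_symmetric_clans[of n]
  by (auto simp: Z_def intro!: finite_same_card_bij)

end
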